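(* Let $(\mathcal{C},\otimes,\mathbb{1})$ be a right-closed monoidal category with equalizers. If $A$ is an algebra in $\mathcal{C}$, then $A\cong[A,A]_A$ as algebras in $\mathcal{C}$.
   Context: Monoidal categories are taken to be strict (by MacLane's strictness theorem). Algebras, right modules and their morphisms in $\mathcal{C}$ are the usual ones (monoid objects, right module objects). $A$ is regarded as a right module over itself via its multiplication. RIGHT-CLOSED. $\mathcal{C}$ is right-closed if each functor $-\otimes Y:\mathcal{C}\to\mathcal{C}$ has a right adjoint $[Y,-]$. Let $\epsilon^Y_Z:[Y,Z]\otimes Y\to Z$ be the counit; the right transpose of a morphism $X\otimes Y\to Z$ is the corresponding morphism $X\to[Y,Z]$. Then $\mathcal{C}$ is enriched over itself with Hom-objects $[X,Y]$, identities $\kappa_X:\mathbb{1}\to[X,X]$ the right transpose of $\mathbb{1}\otimes X\cong X$, and composition $\gamma_{X,Y,Z}:[Y,Z]\otimes[X,Y]\to[X,Z]$ the right transpose of $\epsilon^Y_Z(\mathrm{id}\otimes\epsilon^X_Y)$. THE ALGEBRA $[A,A]_A$. For right $A$-modules $(M,\rho^M)$, $(N,\rho^N)$, $\mathrm{eq}:[M,N]_A\hookrightarrow[M,N]$ is the equalizer of the two morphisms $[M,N]\to[M\otimes A,N]$ that are the right transposes of $\epsilon^M_N(\mathrm{id}_{[M,N]}\otimes\rho^M)$ and $\rho^N(\epsilon^M_N\otimes\mathrm{id}_A)$. There are unique morphisms $\gamma^A_{M,N,P}:[N,P]_A\otimes[M,N]_A\to[M,P]_A$ and $\kappa^A_M:\mathbb{1}\to[M,M]_A$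 with $\mathrm{eq}\,\gamma^A_{M,N,P}=\gamma_{M,N,P}(\mathrm{eq}\otimes\mathrm{eq})$ and $\mathrm{eq}\,\kappa^A_M=\kappa_M$, making $\mathsf{Mod}(\mathcal{C})_A$ enriched over $\mathcal{C}$. The algebra structure on $[A,A]_A$ has multiplication $\gamma^A_{A,A,A}$ and unit $\kappa^A_A$. *)

theory Defs
  imports Main
begin

section \<open>Categories\<close>

record ('o, 'a) category =
  Ob :: "'o set"
  Arr :: "'a set"
  Dom :: "'a \<Rightarrow> 'o"
  Cod :: "'a \<Rightarrow> 'o"
  Ident :: "'o \<Rightarrow> 'a"  ("\<I>\<index>")
  Comp :: "'a \<Rightarrow> 'a \<Rightarrow> 'a"  (infixr "\<cdot>\<index>" 60)

definition hom :: "('o, 'a, 'x) category_scheme \<Rightarrow> 'o \<Rightarrow> 'o \<Rightarrow> 'a set" where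
  "hom C X Y = {f \<in> Arr C. Dom C f = X \<and> Cod C f = Y}"

locale category =
  fixes C :: "('o, 'a, 'x) category_scheme" (structure)
  assumes Dom_Ob: "f \<in> Arr C \<Longrightarrow> Dom C f \<in> Ob C"
    and Cod_Ob: "f \<in> Arr C \<Longrightarrow> Cod C f \<in> Ob C"
    and Ident_hom: "X \<in> Ob C \<Longrightarrow> \<I> X \<in> hom C X X"
    and Comp_hom: "\<lbrakk>f \<in> hom C X Y; g \<in> hom C Y Z\<rbrakk> \<Longrightarrow> g \<cdot> f \<in> hom C X Z"
    and Comp_Ident: "f \<in> hom C X Y \<Longrightarrow> f \<cdot> \<I> X = f"
    and Ident_Comp: "f \<in> hom C X Y \<Longrightarrow> \<I> Y \<cdot> f = f"
    and Comp_assoc: "\<lbrakk>f \<in> hom C W X; g \<in> hom C X Y; h \<in> hom C Y Z\<rbrakk>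
      \<Longrightarrow> (h \<cdot> g) \<cdot> f = h \<cdot> (g \<cdot> f)"

definition is_equalizer :: "('o, 'a, 'x) category_scheme \<Rightarrow> 'a \<Rightarrow> 'a \<Rightarrow> 'a \<Rightarrow> bool" where
  "is_equalizer C e f g \<longleftrightarrow>
     e \<in> hom C (Dom C e) (Dom C f) \<and> f \<cdot>\<^bsub>C\<^esub> e = g \<cdot>\<^bsub>C\<^esub> e \<and>
     (\<forall>W. \<forall>h \<in> hom C W (Dom C f). f \<cdot>\<^bsub>C\<^esub> h = g \<cdot>\<^bsub>C\<^esub> h \<longrightarrow>
        (\<exists>!k. k \<in> hom C W (Dom C e) \<and> e \<cdot>\<^bsub>C\<^esub> k = h))"

definition is_functor ::
  "('o, 'a, 'x) category_scheme \<Rightarrow> ('p, 'b, 'y) category_scheme \<Rightarrow> ('o \<Rightarrow> 'p) \<Rightarrow> ('a \<Rightarrow> 'b) \<Rightarrow> bool"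
where
  "is_functor C D Fo Fa \<longleftrightarrow>
     (\<forall>X \<in> Ob C. Fo X \<in> Ob D \<and> Fa (\<I>\<^bsub>C\<^esub> X) = \<I>\<^bsub>D\<^esub> (Fo X)) \<and>
     (\<forall>X Y. \<forall>f \<in> hom C X Y. Fa f \<in> hom D (Fo X) (Fo Y)) \<and>
     (\<forall>X Y Z. \<forall>f \<in> hom C X Y. \<forall>g \<in> hom C Y Z. Fa (g \<cdot>\<^bsub>C\<^esub> f) = Fa g \<cdot>\<^bsub>D\<^esub> Fa f)"

text \<open>\<open>(Go, Ga)\<close> is right adjoint to \<open>(Fo, Fa)\<close>; \<open>\<phi> X Z\<close> is the natural bijection from the
  morphisms \<open>F X \<rightarrow> Z\<close> to the morphisms \<open>X \<rightarrow> G Z\<close>.\<close>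

definition is_adjunction ::
  "('o, 'a, 'x) category_scheme \<Rightarrow> ('p, 'b, 'y) category_scheme \<Rightarrow> ('o \<Rightarrow> 'p) \<Rightarrow> ('a \<Rightarrow> 'b) \<Rightarrow>
   ('p \<Rightarrow> 'o) \<Rightarrow> ('b \<Rightarrow> 'a) \<Rightarrow> ('o \<Rightarrow> 'p \<Rightarrow> 'b \<Rightarrow> 'a) \<Rightarrow> bool"
where
  "is_adjunction C D Fo Fa Go Ga \<phi> \<longleftrightarrow>
     is_functor C D Fo Fa \<and> is_functor D C Go Ga \<and>
     (\<forall>X \<in> Ob C. \<forall>Z \<in> Ob D. bij_betw (\<phi> X Z) (hom D (Fo X) Z) (hom C X (Go Z))) \<and>
     (\<forall>X' X Z. \<forall>u \<in> hom C X' X. \<forall>f \<in> hom D (Fo X) Z.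
        \<phi> X' Z (f \<cdot>\<^bsub>D\<^esub> Fa u) = \<phi> X Z f \<cdot>\<^bsub>C\<^esub> u) \<and>
     (\<forall>X Z Z'. \<forall>f \<in> hom D (Fo X) Z. \<forall>v \<in> hom D Z Z'. X \<in> Ob C \<longrightarrow>
        \<phi> X Z' (v \<cdot>\<^bsub>D\<^esub> f) = Ga v \<cdot>\<^bsub>C\<^esub> \<phi> X Z f)"


section \<open>Strict monoidal categories\<close>

text \<open>\<open>\<otimes>\<close> is the tensor product of objects and \<open>\<boxtimes>\<close> the tensor product of morphisms.\<close>

record ('o, 'a) monoidal = "('o, 'a) category" +
  TensorO :: "'o \<Rightarrow> 'o \<Rightarrow> 'o"  (infixr "\<otimes>\<index>" 70)
  TensorA :: "'a \<Rightarrow> 'a \<Rightarrow> 'a"  (infixr "\<boxtimes>\<index>" 70)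
  Unit :: 'o  ("\<one>\<index>")

locale strict_monoidal_category = category C
  for C :: "('o, 'a, 'x) monoidal_scheme" (structure) +
  assumes Unit_Ob: "\<one> \<in> Ob C"
    and Tensor_Ob: "\<lbrakk>X \<in> Ob C; Y \<in> Ob C\<rbrakk> \<Longrightarrow> X \<otimes> Y \<in> Ob C"
    and Tensor_hom: "\<lbrakk>f \<in> hom C X Y; g \<in> hom C X' Y'\<rbrakk> \<Longrightarrow> f \<boxtimes> g \<in> hom C (X \<otimes> X') (Y \<otimes> Y')"
    and Tensor_Ident: "\<lbrakk>X \<in> Ob C; Y \<in> Ob C\<rbrakk> \<Longrightarrow> \<I> X \<boxtimes> \<I> Y = \<I> (X \<otimes> Y)"
    and Tensor_Comp: "\<lbrakk>f \<in> hom C X Y; g \<in> hom C Y Z; f' \<in> hom C X' Y'; g' \<in> hom C Y' Z'\<rbrakk>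
      \<Longrightarrow> (g \<cdot> f) \<boxtimes> (g' \<cdot> f') = (g \<boxtimes> g') \<cdot> (f \<boxtimes> f')"
    and TensorO_assoc: "\<lbrakk>X \<in> Ob C; Y \<in> Ob C; Z \<in> Ob C\<rbrakk> \<Longrightarrow> (X \<otimes> Y) \<otimes> Z = X \<otimes> (Y \<otimes> Z)"
    and TensorA_assoc: "\<lbrakk>f \<in> Arr C; g \<in> Arr C; h \<in> Arr C\<rbrakk> \<Longrightarrow> (f \<boxtimes> g) \<boxtimes> h = f \<boxtimes> (g \<boxtimes> h)"
    and Unit_TensorO: "X \<in> Ob C \<Longrightarrow> \<one> \<otimes> X = X"
    and TensorO_Unit: "X \<in> Ob C \<Longrightarrow> X \<otimes> \<one> = X"
    and Unit_TensorA: "f \<in> Arr C \<Longrightarrow> \<I> \<one> \<boxtimes> f = f"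
    and TensorA_Unit: "f \<in> Arr C \<Longrightarrow> f \<boxtimes> \<I> \<one> = f"


section \<open>Right-closed monoidal categories with equalizers\<close>

text \<open>The right adjoints and the equalizers are part of the structure, so results about it hold for
  every choice of them. \<open>IHom Y Z\<close> is \<open>[Y,Z]\<close>, \<open>IHomA Y\<close> is the action of \<open>[Y,-]\<close> on
  morphisms, and \<open>Transpose X Y Z\<close> sends a morphism \<open>X \<otimes> Y \<rightarrow> Z\<close> to its right transpose
  \<open>X \<rightarrow> [Y,Z]\<close>; the index \<open>X\<close> is needed because \<open>X \<otimes> Y\<close> does not determine it.\<close>

record ('o, 'a) closed_monoidal = "('o, 'a) monoidal" +
  IHom :: "'o \<Rightarrow> 'o \<Rightarrow> 'o"
  IHomA :: "'o \<Rightarrow> 'a \<Rightarrow> 'a"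
  Transpose :: "'o \<Rightarrow> 'o \<Rightarrow> 'o \<Rightarrow> 'a \<Rightarrow> 'a"

locale right_closed_monoidal_category = strict_monoidal_category C
  for C :: "('o, 'a, 'x) closed_monoidal_scheme" (structure) +
  assumes right_adjoint: "Y \<in> Ob C \<Longrightarrow>
    is_adjunction C C (\<lambda>X. X \<otimes> Y) (\<lambda>f. f \<boxtimes> \<I> Y) (IHom C Y) (IHomA C Y) (\<lambda>X Z. Transpose C X Y Z)"

record ('o, 'a) closed_monoidal_eq = "('o, 'a) closed_monoidal" +
  Equalizer :: "'a \<Rightarrow> 'a \<Rightarrow> 'a"

locale right_closed_monoidal_category_with_equalizers = right_closed_monoidal_category C
  for C :: "('o, 'a, 'x) closed_monoidal_eq_scheme" (structure) +
  assumes equalizer: "\<lbrakk>f \<in> hom C X Y; g \<in> hom C X Y\<rbrakk> \<Longrightarrow> is_equalizer C (Equalizer C f g) f g"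

definition counit :: "('o, 'a, 'x) closed_monoidal_scheme \<Rightarrow> 'o \<Rightarrow> 'o \<Rightarrow> 'a"  ("\<epsilon>\<index>") where
  "\<epsilon>\<^bsub>C\<^esub> Y Z = inv_into (hom C (IHom C Y Z \<otimes>\<^bsub>C\<^esub> Y) Z) (Transpose C (IHom C Y Z) Y Z) (\<I>\<^bsub>C\<^esub> (IHom C Y Z))"

definition ihom_id :: "('o, 'a, 'x) closed_monoidal_scheme \<Rightarrow> 'o \<Rightarrow> 'a"  ("\<kappa>\<index>") where
  "\<kappa>\<^bsub>C\<^esub> X = Transpose C \<one>\<^bsub>C\<^esub> X X (\<I>\<^bsub>C\<^esub> X)"

definition ihom_comp :: "('o, 'a, 'x) closed_monoidal_scheme \<Rightarrow> 'o \<Rightarrow> 'o \<Rightarrow> 'o \<Rightarrow> 'a"  ("\<gamma>\<index>") where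
  "\<gamma>\<^bsub>C\<^esub> X Y Z = Transpose C (IHom C Y Z \<otimes>\<^bsub>C\<^esub> IHom C X Y) X Z
     (\<epsilon>\<^bsub>C\<^esub> Y Z \<cdot>\<^bsub>C\<^esub> (\<I>\<^bsub>C\<^esub> (IHom C Y Z) \<boxtimes>\<^bsub>C\<^esub> \<epsilon>\<^bsub>C\<^esub> X Y))"


section \<open>Algebras and modules\<close>

record ('o, 'a) alg =
  alg_obj :: 'o
  alg_mult :: 'a
  alg_unit :: 'a

definition is_algebra :: "('o, 'a, 'x) monoidal_scheme \<Rightarrow> ('o, 'a) alg \<Rightarrow> bool" where
  "is_algebra C A \<longleftrightarrow> (let X = alg_obj A; m = alg_mult A; u = alg_unit A in
     X \<in> Ob C \<and> m \<in> hom C (X \<otimes>\<^bsub>C\<^esub> X) X \<and> u \<in> hom C \<one>\<^bsub>C\<^esub> X \<and>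
     m \<cdot>\<^bsub>C\<^esub> (m \<boxtimes>\<^bsub>C\<^esub> \<I>\<^bsub>C\<^esub> X) = m \<cdot>\<^bsub>C\<^esub> (\<I>\<^bsub>C\<^esub> X \<boxtimes>\<^bsub>C\<^esub> m) \<and>
     m \<cdot>\<^bsub>C\<^esub> (u \<boxtimes>\<^bsub>C\<^esub> \<I>\<^bsub>C\<^esub> X) = \<I>\<^bsub>C\<^esub> X \<and>
     m \<cdot>\<^bsub>C\<^esub> (\<I>\<^bsub>C\<^esub> X \<boxtimes>\<^bsub>C\<^esub> u) = \<I>\<^bsub>C\<^esub> X)"

definition is_algebra_hom ::
  "('o, 'a, 'x) monoidal_scheme \<Rightarrow> ('o, 'a) alg \<Rightarrow> ('o, 'a) alg \<Rightarrow> 'a \<Rightarrow> bool" where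
  "is_algebra_hom C A B f \<longleftrightarrow>
     f \<in> hom C (alg_obj A) (alg_obj B) \<and>
     f \<cdot>\<^bsub>C\<^esub> alg_mult A = alg_mult B \<cdot>\<^bsub>C\<^esub> (f \<boxtimes>\<^bsub>C\<^esub> f) \<and>
     f \<cdot>\<^bsub>C\<^esub> alg_unit A = alg_unit B"

definition isomorphic_algebras ::
  "('o, 'a, 'x) monoidal_scheme \<Rightarrow> ('o, 'a) alg \<Rightarrow> ('o, 'a) alg \<Rightarrow> bool" where
  "isomorphic_algebras C A B \<longleftrightarrow> is_algebra C A \<and> is_algebra C B \<and>
     (\<exists>f g. is_algebra_hom C A B f \<and> is_algebra_hom C B A g \<and>
        g \<cdot>\<^bsub>C\<^esub> f = \<I>\<^bsub>C\<^esub> (alg_obj A) \<and> f \<cdot>\<^bsub>C\<^esub> g = \<I>\<^bsub>C\<^esub> (alg_obj B))"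

record ('o, 'a) rmod =
  mod_obj :: 'o
  mod_act :: 'a

definition is_right_module ::
  "('o, 'a, 'x) monoidal_scheme \<Rightarrow> ('o, 'a) alg \<Rightarrow> ('o, 'a) rmod \<Rightarrow> bool" where
  "is_right_module C A M \<longleftrightarrow> (let X = mod_obj M; r = mod_act M in
     X \<in> Ob C \<and> r \<in> hom C (X \<otimes>\<^bsub>C\<^esub> alg_obj A) X \<and>
     r \<cdot>\<^bsub>C\<^esub> (r \<boxtimes>\<^bsub>C\<^esub> \<I>\<^bsub>C\<^esub> (alg_obj A)) = r \<cdot>\<^bsub>C\<^esub> (\<I>\<^bsub>C\<^esub> X \<boxtimes>\<^bsub>C\<^esub> alg_mult A) \<and>
     r \<cdot>\<^bsub>C\<^esub> (\<I>\<^bsub>C\<^esub> X \<boxtimes>\<^bsub>C\<^esub> alg_unit A) = \<I>\<^bsub>C\<^esub> X)"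

definition regular_module :: "('o, 'a) alg \<Rightarrow> ('o, 'a) rmod" where
  "regular_module A = \<lparr>mod_obj = alg_obj A, mod_act = alg_mult A\<rparr>"

lemma is_right_module_regular: "is_algebra C A \<Longrightarrow> is_right_module C A (regular_module A)"
  by (simp add: is_algebra_def is_right_module_def regular_module_def Let_def)


section \<open>The algebra of module endomorphisms\<close>

text \<open>\<open>mod_eq C A M N\<close> is the inclusion of \<open>[M,N]\<^sub>A\<close> into \<open>[M,N]\<close>.\<close>

definition mod_eq ::
  "('o, 'a, 'x) closed_monoidal_eq_scheme \<Rightarrow> ('o, 'a) alg \<Rightarrow> ('o, 'a) rmod \<Rightarrow> ('o, 'a) rmod \<Rightarrow> 'a" where
  "mod_eq C A M N = (let X = mod_obj M; Y = mod_obj N; H = IHom C X Y in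
     Equalizer C
       (Transpose C H (X \<otimes>\<^bsub>C\<^esub> alg_obj A) Y (\<epsilon>\<^bsub>C\<^esub> X Y \<cdot>\<^bsub>C\<^esub> (\<I>\<^bsub>C\<^esub> H \<boxtimes>\<^bsub>C\<^esub> mod_act M)))
       (Transpose C H (X \<otimes>\<^bsub>C\<^esub> alg_obj A) Y (mod_act N \<cdot>\<^bsub>C\<^esub> (\<epsilon>\<^bsub>C\<^esub> X Y \<boxtimes>\<^bsub>C\<^esub> \<I>\<^bsub>C\<^esub> (alg_obj A)))))"

definition mod_hom ::
  "('o, 'a, 'x) closed_monoidal_eq_scheme \<Rightarrow> ('o, 'a) alg \<Rightarrow> ('o, 'a) rmod \<Rightarrow> ('o, 'a) rmod \<Rightarrow> 'o" where
  "mod_hom C A M N = Dom C (mod_eq C A M N)"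

definition mod_comp ::
  "('o, 'a, 'x) closed_monoidal_eq_scheme \<Rightarrow> ('o, 'a) alg \<Rightarrow> ('o, 'a) rmod \<Rightarrow> ('o, 'a) rmod \<Rightarrow> ('o, 'a) rmod \<Rightarrow> 'a" where
  "mod_comp C A M N P =
     (THE h. h \<in> hom C (mod_hom C A N P \<otimes>\<^bsub>C\<^esub> mod_hom C A M N) (mod_hom C A M P) \<and>
        mod_eq C A M P \<cdot>\<^bsub>C\<^esub> h =
          \<gamma>\<^bsub>C\<^esub> (mod_obj M) (mod_obj N) (mod_obj P) \<cdot>\<^bsub>C\<^esub> (mod_eq C A N P \<boxtimes>\<^bsub>C\<^esub> mod_eq C A M N))"

definition mod_id ::
  "('o, 'a, 'x) closed_monoidal_eq_scheme \<Rightarrow> ('o, 'a) alg \<Rightarrow> ('o, 'a) rmod \<Rightarrow> 'a" where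
  "mod_id C A M =
     (THE h. h \<in> hom C \<one>\<^bsub>C\<^esub> (mod_hom C A M M) \<and> mod_eq C A M M \<cdot>\<^bsub>C\<^esub> h = \<kappa>\<^bsub>C\<^esub> (mod_obj M))"

definition mod_end ::
  "('o, 'a, 'x) closed_monoidal_eq_scheme \<Rightarrow> ('o, 'a) alg \<Rightarrow> ('o, 'a) rmod \<Rightarrow> ('o, 'a) alg" where
  "mod_end C A M =
     \<lparr>alg_obj = mod_hom C A M M, alg_mult = mod_comp C A M M M, alg_unit = mod_id C A M\<rparr>"

text \<open>For right modules, \<open>mod_comp\<close> and \<open>mod_id\<close> are well defined.\<close>

lemma (in category) hom_Ob: "f \<in> hom C X Y \<Longrightarrow> X \<in> Ob C" "f \<in> hom C X Y \<Longrightarrow> Y \<in> Ob C"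
  using Dom_Ob Cod_Ob by (auto simp: hom_def)

lemma (in category) hom_Arr: "f \<in> hom C X Y \<Longrightarrow> f \<in> Arr C"
  by (simp add: hom_def)

lemma (in category) is_equalizerD:
  assumes "is_equalizer C e f g" "f \<in> hom C X Y"
  shows "e \<in> hom C (Dom C e) X" "f \<cdot> e = g \<cdot> e"
    and "\<lbrakk>h \<in> hom C W X; f \<cdot> h = g \<cdot> h\<rbrakk> \<Longrightarrow> \<exists>!k. k \<in> hom C W (Dom C e) \<and> e \<cdot> k = h"
proof -
  have "Dom C f = X" using assms(2) by (simp add: hom_def)
  then show "e \<in> hom C (Dom C e) X" "f \<cdot> e = g \<cdot> e"
    and "\<lbrakk>h \<in> hom C W X; f \<cdot> h = g \<cdot> h\<rbrakk> \<Longrightarrow> \<exists>!k. k \<in> hom C W (Dom C e) \<and> e \<cdot> k = h"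
    using assms(1) unfolding is_equalizer_def by auto
qed

context strict_monoidal_category
begin

lemma Comp_Tensor:
  "\<lbrakk>f \<in> hom C X Y; g \<in> hom C Y Z; f' \<in> hom C X' Y'; g' \<in> hom C Y' Z'\<rbrakk>
    \<Longrightarrow> (g \<boxtimes> g') \<cdot> (f \<boxtimes> f') = (g \<cdot> f) \<boxtimes> (g' \<cdot> f')"
  by (simp add: Tensor_Comp)

end

context right_closed_monoidal_category
begin

lemma IHom_Ob: "\<lbrakk>Y \<in> Ob C; Z \<in> Ob C\<rbrakk> \<Longrightarrow> IHom C Y Z \<in> Ob C"
  using right_adjoint[of Y] by (simp add: is_adjunction_def is_functor_def)

lemma Transpose_bij:
  "\<lbrakk>X \<in> Ob C; Y \<in> Ob C; Z \<in> Ob C\<rbrakk>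
    \<Longrightarrow> bij_betw (Transpose C X Y Z) (hom C (X \<otimes> Y) Z) (hom C X (IHom C Y Z))"
  using right_adjoint[of Y] by (simp add: is_adjunction_def)

lemma Transpose_hom:
  "\<lbrakk>X \<in> Ob C; Y \<in> Ob C; f \<in> hom C (X \<otimes> Y) Z\<rbrakk> \<Longrightarrow> Transpose C X Y Z f \<in> hom C X (IHom C Y Z)"
  using Transpose_bij[of X Y Z] hom_Ob(2)[of f] by (auto simp: bij_betw_def)

lemma Transpose_natural:
  "\<lbrakk>u \<in> hom C W X; Y \<in> Ob C; f \<in> hom C (X \<otimes> Y) Z\<rbrakk>
    \<Longrightarrow> Transpose C X Y Z f \<cdot> u = Transpose C W Y Z (f \<cdot> (u \<boxtimes> \<I> Y))"
  using right_adjoint[of Y] unfolding is_adjunction_def by metis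

lemma counit_hom: "\<lbrakk>Y \<in> Ob C; Z \<in> Ob C\<rbrakk> \<Longrightarrow> \<epsilon> Y Z \<in> hom C (IHom C Y Z \<otimes> Y) Z"
  unfolding counit_def
  by (rule inv_into_into)
    (simp add: bij_betw_imp_surj_on[OF Transpose_bij] IHom_Ob Ident_hom)

lemma Transpose_counit:
  "\<lbrakk>Y \<in> Ob C; Z \<in> Ob C\<rbrakk> \<Longrightarrow> Transpose C (IHom C Y Z) Y Z (\<epsilon> Y Z) = \<I> (IHom C Y Z)"
  unfolding counit_def
  by (rule f_inv_into_f)
    (simp add: bij_betw_imp_surj_on[OF Transpose_bij] IHom_Ob Ident_hom)

lemma Transpose_counit_Comp:
  assumes "h \<in> hom C X (IHom C Y Z)" "Y \<in> Ob C" "Z \<in> Ob C"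
  shows "Transpose C X Y Z (\<epsilon> Y Z \<cdot> (h \<boxtimes> \<I> Y)) = h"
  using assms Transpose_natural[OF assms(1,2) counit_hom[OF assms(2,3)]]
  by (simp add: Transpose_counit Ident_Comp)

lemma counit_Transpose:
  assumes "X \<in> Ob C" "Y \<in> Ob C" "f \<in> hom C (X \<otimes> Y) Z"
  shows "\<epsilon> Y Z \<cdot> (Transpose C X Y Z f \<boxtimes> \<I> Y) = f"
proof -
  have Z: "Z \<in> Ob C" using assms(3) hom_Ob by blast
  have T: "Transpose C X Y Z f \<in> hom C X (IHom C Y Z)" using assms by (rule Transpose_hom)
  have "\<epsilon> Y Z \<cdot> (Transpose C X Y Z f \<boxtimes> \<I> Y) \<in> hom C (X \<otimes> Y) Z"
    using Tensor_hom[OF T Ident_hom[OF assms(2)]] counit_hom[OF assms(2) Z] by (rule Comp_hom)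
  then show ?thesis
    using inj_onD[OF bij_betw_imp_inj_on[OF Transpose_bij[OF assms(1,2) Z]]
        Transpose_counit_Comp[OF T assms(2) Z] _ assms(3)] by simp
qed

text \<open>A morphism into \<open>[X,Y]\<close> equalizes the pair defining \<open>[M,N]\<^sub>A\<close> iff it is pointwise a
  module morphism.\<close>

lemma mod_pair:
  assumes M: "is_right_module C A M" and N: "is_right_module C A N" and A: "alg_obj A \<in> Ob C"
    and X: "X = mod_obj M" and Y: "Y = mod_obj N" and H: "H = IHom C X Y"
    and p: "p = Transpose C H (X \<otimes> alg_obj A) Y (\<epsilon> X Y \<cdot> (\<I> H \<boxtimes> mod_act M))"
    and q: "q = Transpose C H (X \<otimes> alg_obj A) Y (mod_act N \<cdot> (\<epsilon> X Y \<boxtimes> \<I> (alg_obj A)))"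
  shows "p \<in> hom C H (IHom C (X \<otimes> alg_obj A) Y)"
    and "q \<in> hom C H (IHom C (X \<otimes> alg_obj A) Y)"
    and "k \<in> hom C W H \<Longrightarrow> p \<cdot> k = q \<cdot> k \<longleftrightarrow>
      \<epsilon> X Y \<cdot> (k \<boxtimes> mod_act M) = mod_act N \<cdot> ((\<epsilon> X Y \<cdot> (k \<boxtimes> \<I> X)) \<boxtimes> \<I> (alg_obj A))"
proof -
  let ?A = "alg_obj A"
  have XO: "X \<in> Ob C" and YO: "Y \<in> Ob C" and rM: "mod_act M \<in> hom C (X \<otimes> ?A) X"
    and rN: "mod_act N \<in> hom C (Y \<otimes> ?A) Y"
    using M N by (auto simp: is_right_module_def Let_def X Y)
  have HO: "H \<in> Ob C" using XO YO by (simp add: H IHom_Ob)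
  have XA: "X \<otimes> ?A \<in> Ob C" using XO A by (rule Tensor_Ob)
  have e: "\<epsilon> X Y \<in> hom C (H \<otimes> X) Y" unfolding H using XO YO by (rule counit_hom)
  have p1: "\<I> H \<boxtimes> mod_act M \<in> hom C (H \<otimes> X \<otimes> ?A) (H \<otimes> X)"
    using Ident_hom[OF HO] rM by (rule Tensor_hom)
  have p0: "\<epsilon> X Y \<cdot> (\<I> H \<boxtimes> mod_act M) \<in> hom C (H \<otimes> X \<otimes> ?A) Y"
    using p1 e by (rule Comp_hom)
  have q1: "\<epsilon> X Y \<boxtimes> \<I> ?A \<in> hom C (H \<otimes> X \<otimes> ?A) (Y \<otimes> ?A)"
    using Tensor_hom[OF e Ident_hom[OF A]] by (simp add: TensorO_assoc HO XO A)
  have q0: "mod_act N \<cdot> (\<epsilon> X Y \<boxtimes> \<I> ?A) \<in> hom C (H \<otimes> X \<otimes> ?A) Y"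
    using q1 rN by (rule Comp_hom)
  show pH: "p \<in> hom C H (IHom C (X \<otimes> ?A) Y)" unfolding p using HO XA p0 by (rule Transpose_hom)
  show qH: "q \<in> hom C H (IHom C (X \<otimes> ?A) Y)" unfolding q using HO XA q0 by (rule Transpose_hom)
  assume k: "k \<in> hom C W H"
  have WO: "W \<in> Ob C" using k hom_Ob by blast
  let ?k = "k \<boxtimes> \<I> (X \<otimes> ?A)"
  have kk: "?k \<in> hom C (W \<otimes> X \<otimes> ?A) (H \<otimes> X \<otimes> ?A)" using k Ident_hom[OF XA] by (rule Tensor_hom)
  have kX: "k \<boxtimes> \<I> X \<in> hom C (W \<otimes> X) (H \<otimes> X)" using k Ident_hom[OF XO] by (rule Tensor_hom)
  have "p \<cdot> k = Transpose C W (X \<otimes> ?A) Y ((\<epsilon> X Y \<cdot> (\<I> H \<boxtimes> mod_act M)) \<cdot> ?k)"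
    unfolding p using k XA p0 by (rule Transpose_natural)
  moreover have "q \<cdot> k = Transpose C W (X \<otimes> ?A) Y ((mod_act N \<cdot> (\<epsilon> X Y \<boxtimes> \<I> ?A)) \<cdot> ?k)"
    unfolding q using k XA q0 by (rule Transpose_natural)
  ultimately have "p \<cdot> k = q \<cdot> k \<longleftrightarrow>
      (\<epsilon> X Y \<cdot> (\<I> H \<boxtimes> mod_act M)) \<cdot> ?k = (mod_act N \<cdot> (\<epsilon> X Y \<boxtimes> \<I> ?A)) \<cdot> ?k"
    using inj_on_eq_iff[OF bij_betw_imp_inj_on[OF Transpose_bij[OF WO XA YO]]
        Comp_hom[OF kk p0] Comp_hom[OF kk q0]] by simp
  moreover have "(\<epsilon> X Y \<cdot> (\<I> H \<boxtimes> mod_act M)) \<cdot> ?k = \<epsilon> X Y \<cdot> (k \<boxtimes> mod_act M)"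
    using Comp_assoc[OF kk p1 e] Comp_Tensor[OF k Ident_hom[OF HO] Ident_hom[OF XA] rM] k rM
    by (simp add: Ident_Comp Comp_Ident)
  moreover have "?k = (k \<boxtimes> \<I> X) \<boxtimes> \<I> ?A"
    using k Ident_hom XO A by (simp add: TensorA_assoc hom_Arr[OF k] hom_Arr[OF Ident_hom] Tensor_Ident)
  moreover have "(mod_act N \<cdot> (\<epsilon> X Y \<boxtimes> \<I> ?A)) \<cdot> ?k = mod_act N \<cdot> ((\<epsilon> X Y \<cdot> (k \<boxtimes> \<I> X)) \<boxtimes> \<I> ?A)"
    using Comp_assoc[OF kk q1 rN] Comp_Tensor[OF kX e Ident_hom[OF A] Ident_hom[OF A]] \<open>?k = _\<close>
    by (simp add: Comp_Ident[OF Ident_hom[OF A]])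
  ultimately show "p \<cdot> k = q \<cdot> k \<longleftrightarrow>
      \<epsilon> X Y \<cdot> (k \<boxtimes> mod_act M) = mod_act N \<cdot> ((\<epsilon> X Y \<cdot> (k \<boxtimes> \<I> X)) \<boxtimes> \<I> ?A)"
    by simp
qed

end

context right_closed_monoidal_category_with_equalizers
begin

lemma mod_eq_hom:
  assumes "is_right_module C A M" "is_right_module C A N" "alg_obj A \<in> Ob C"
  shows "mod_eq C A M N \<in> hom C (mod_hom C A M N) (IHom C (mod_obj M) (mod_obj N))"
proof -
  note P = mod_pair[OF assms refl refl refl refl refl]
  show ?thesis
    using is_equalizerD(1)[OF equalizer[OF P(1,2)] P(1)]
    unfolding mod_hom_def mod_eq_def Let_def .
qed

lemma mod_eq_pointwise:
  assumes "is_right_module C A M" "is_right_module C A N" "alg_obj A \<in> Ob C"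
  shows "\<epsilon> (mod_obj M) (mod_obj N) \<cdot> (mod_eq C A M N \<boxtimes> mod_act M) =
    mod_act N \<cdot> ((\<epsilon> (mod_obj M) (mod_obj N) \<cdot> (mod_eq C A M N \<boxtimes> \<I> (mod_obj M))) \<boxtimes> \<I> (alg_obj A))"
proof -
  note P = mod_pair[OF assms refl refl refl refl refl]
  show ?thesis
    unfolding P(3)[OF mod_eq_hom[OF assms], symmetric]
    using is_equalizerD(2)[OF equalizer[OF P(1,2)] P(1)]
    unfolding mod_eq_def Let_def .
qed

lemma mod_eq_lift:
  assumes "is_right_module C A M" "is_right_module C A N" "alg_obj A \<in> Ob C"
    and k: "k \<in> hom C W (IHom C (mod_obj M) (mod_obj N))"
    and "\<epsilon> (mod_obj M) (mod_obj N) \<cdot> (k \<boxtimes> mod_act M) =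
      mod_act N \<cdot> ((\<epsilon> (mod_obj M) (mod_obj N) \<cdot> (k \<boxtimes> \<I> (mod_obj M))) \<boxtimes> \<I> (alg_obj A))"
  shows "\<exists>!h. h \<in> hom C W (mod_hom C A M N) \<and> mod_eq C A M N \<cdot> h = k"
proof -
  note P = mod_pair[OF assms(1-3) refl refl refl refl refl]
  show ?thesis
    using is_equalizerD(3)[OF equalizer[OF P(1,2)] P(1) k iffD2[OF P(3)[OF k] assms(5)]]
    unfolding mod_hom_def mod_eq_def Let_def .
qed

lemma mod_id_unique:
  assumes M: "is_right_module C A M" and A: "alg_obj A \<in> Ob C"
  shows "\<exists>!h. h \<in> hom C \<one> (mod_hom C A M M) \<and> mod_eq C A M M \<cdot> h = \<kappa> (mod_obj M)"
proof -
  let ?X = "mod_obj M" and ?A = "alg_obj A"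
  have X: "?X \<in> Ob C" and r: "mod_act M \<in> hom C (?X \<otimes> ?A) ?X"
    using M by (auto simp: is_right_module_def Let_def)
  have i: "\<I> ?X \<in> hom C (\<one> \<otimes> ?X) ?X" using Ident_hom[OF X] by (simp add: Unit_TensorO X)
  have k: "\<kappa> ?X \<in> hom C \<one> (IHom C ?X ?X)"
    unfolding ihom_id_def using Unit_Ob X i by (rule Transpose_hom)
  have ek: "\<epsilon> ?X ?X \<cdot> (\<kappa> ?X \<boxtimes> \<I> ?X) = \<I> ?X"
    unfolding ihom_id_def using Unit_Ob X i by (rule counit_Transpose)
  have kX: "\<kappa> ?X \<boxtimes> \<I> ?X \<in> hom C (\<one> \<otimes> ?X) (IHom C ?X ?X \<otimes> ?X)"
    using k Ident_hom[OF X] by (rule Tensor_hom)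
  have r1: "\<I> \<one> \<boxtimes> mod_act M \<in> hom C (\<one> \<otimes> ?X \<otimes> ?A) (\<one> \<otimes> ?X)"
    using Ident_hom[OF Unit_Ob] r by (rule Tensor_hom)
  have "\<epsilon> ?X ?X \<cdot> (\<kappa> ?X \<boxtimes> mod_act M) = \<epsilon> ?X ?X \<cdot> (\<kappa> ?X \<boxtimes> \<I> ?X) \<cdot> (\<I> \<one> \<boxtimes> mod_act M)"
    using Comp_Tensor[OF Ident_hom[OF Unit_Ob] k r Ident_hom[OF X]] k r
    by (simp add: Comp_Ident Ident_Comp)
  also have "\<dots> = (\<epsilon> ?X ?X \<cdot> (\<kappa> ?X \<boxtimes> \<I> ?X)) \<cdot> (\<I> \<one> \<boxtimes> mod_act M)"
    using Comp_assoc[OF r1 kX counit_hom[OF X X]] by simp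
  also have "\<dots> = mod_act M"
    unfolding ek using r by (simp add: Unit_TensorA[OF hom_Arr[OF r]] Ident_Comp)
  also have "\<dots> = mod_act M \<cdot> ((\<epsilon> ?X ?X \<cdot> (\<kappa> ?X \<boxtimes> \<I> ?X)) \<boxtimes> \<I> ?A)"
    unfolding ek using r by (simp add: Tensor_Ident X A Comp_Ident)
  finally show ?thesis by (rule mod_eq_lift[OF M M A k])
qed

lemma mod_comp_unique:
  assumes M: "is_right_module C A M" and N: "is_right_module C A N" and P: "is_right_module C A P"
    and A: "alg_obj A \<in> Ob C"
  shows "\<exists>!h. h \<in> hom C (mod_hom C A N P \<otimes> mod_hom C A M N) (mod_hom C A M P) \<and>
    mod_eq C A M P \<cdot> h = \<gamma> (mod_obj M) (mod_obj N) (mod_obj P) \<cdot> (mod_eq C A N P \<boxtimes> mod_eq C A M N)"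
proof -
  let ?A = "alg_obj A"
  define X Y Z where XYZ: "X = mod_obj M" "Y = mod_obj N" "Z = mod_obj P"
  define r s t where rst: "r = mod_act M" "s = mod_act N" "t = mod_act P"
  define D E where DE: "D = mod_hom C A N P" "E = mod_hom C A M N"
  define d e where de: "d = mod_eq C A N P" "e = mod_eq C A M N"
  have X: "X \<in> Ob C" and r: "r \<in> hom C (X \<otimes> ?A) X" and Y: "Y \<in> Ob C" and s: "s \<in> hom C (Y \<otimes> ?A) Y"
    and Z: "Z \<in> Ob C" and t: "t \<in> hom C (Z \<otimes> ?A) Z"
    using M N P by (auto simp: is_right_module_def Let_def XYZ rst)
  let ?H = "IHom C X Y" and ?K = "IHom C Y Z"
  have H: "?H \<in> Ob C" and K: "?K \<in> Ob C" using X Y Z by (simp_all add: IHom_Ob)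
  have d: "d \<in> hom C D ?K" and e: "e \<in> hom C E ?H"
    unfolding de DE XYZ using mod_eq_hom M N P A by auto
  have D: "D \<in> Ob C" and E: "E \<in> Ob C" using d e hom_Ob by auto
  have dp: "\<epsilon> Y Z \<cdot> (d \<boxtimes> s) = t \<cdot> ((\<epsilon> Y Z \<cdot> (d \<boxtimes> \<I> Y)) \<boxtimes> \<I> ?A)"
    unfolding de XYZ rst using N P A by (rule mod_eq_pointwise)
  have ep: "\<epsilon> X Y \<cdot> (e \<boxtimes> r) = s \<cdot> ((\<epsilon> X Y \<cdot> (e \<boxtimes> \<I> X)) \<boxtimes> \<I> ?A)"
    unfolding de XYZ rst using M N A by (rule mod_eq_pointwise)
  have cXY: "\<epsilon> X Y \<in> hom C (?H \<otimes> X) Y" and cYZ: "\<epsilon> Y Z \<in> hom C (?K \<otimes> Y) Z"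
    and cXZ: "\<epsilon> X Z \<in> hom C (IHom C X Z \<otimes> X) Z"
    using X Y Z by (simp_all add: counit_hom)
  have g2: "\<I> ?K \<boxtimes> \<epsilon> X Y \<in> hom C ((?K \<otimes> ?H) \<otimes> X) (?K \<otimes> Y)"
    using Tensor_hom[OF Ident_hom[OF K] cXY] by (simp add: TensorO_assoc K H X)
  have KH: "?K \<otimes> ?H \<in> Ob C" using K H by (rule Tensor_Ob)
  have g1: "\<epsilon> Y Z \<cdot> (\<I> ?K \<boxtimes> \<epsilon> X Y) \<in> hom C ((?K \<otimes> ?H) \<otimes> X) Z" using g2 cYZ by (rule Comp_hom)
  have g: "\<gamma> X Y Z \<in> hom C (?K \<otimes> ?H) (IHom C X Z)"
    unfolding ihom_comp_def using KH X g1 by (rule Transpose_hom)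
  have eg: "\<epsilon> X Z \<cdot> (\<gamma> X Y Z \<boxtimes> \<I> X) = \<epsilon> Y Z \<cdot> (\<I> ?K \<boxtimes> \<epsilon> X Y)"
    unfolding ihom_comp_def using KH X g1 by (rule counit_Transpose)
  have de': "d \<boxtimes> e \<in> hom C (D \<otimes> E) (?K \<otimes> ?H)" using d e by (rule Tensor_hom)
  define k where "k = \<gamma> X Y Z \<cdot> (d \<boxtimes> e)"
  have k: "k \<in> hom C (D \<otimes> E) (IHom C X Z)" unfolding k_def using de' g by (rule Comp_hom)
  have app: "\<epsilon> X Z \<cdot> (k \<boxtimes> x) = \<epsilon> Y Z \<cdot> (d \<boxtimes> (\<epsilon> X Y \<cdot> (e \<boxtimes> x)))"
    if x: "x \<in> hom C V X" for x V
  proof -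
    have V: "V \<in> Ob C" using x hom_Ob by blast
    have dex: "(d \<boxtimes> e) \<boxtimes> x \<in> hom C ((D \<otimes> E) \<otimes> V) ((?K \<otimes> ?H) \<otimes> X)" using de' x by (rule Tensor_hom)
    have gX: "\<gamma> X Y Z \<boxtimes> \<I> X \<in> hom C ((?K \<otimes> ?H) \<otimes> X) (IHom C X Z \<otimes> X)"
      using g Ident_hom[OF X] by (rule Tensor_hom)
    have ex: "e \<boxtimes> x \<in> hom C (E \<otimes> V) (?H \<otimes> X)" using e x by (rule Tensor_hom)
    have "k \<boxtimes> x = (\<gamma> X Y Z \<boxtimes> \<I> X) \<cdot> ((d \<boxtimes> e) \<boxtimes> x)"
      unfolding k_def using Comp_Tensor[OF de' g x Ident_hom[OF X]] x by (simp add: Ident_Comp)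
    then have "\<epsilon> X Z \<cdot> (k \<boxtimes> x) = (\<epsilon> X Z \<cdot> (\<gamma> X Y Z \<boxtimes> \<I> X)) \<cdot> ((d \<boxtimes> e) \<boxtimes> x)"
      using Comp_assoc[OF dex gX cXZ] by simp
    also have "\<dots> = \<epsilon> Y Z \<cdot> (\<I> ?K \<boxtimes> \<epsilon> X Y) \<cdot> ((d \<boxtimes> e) \<boxtimes> x)"
      unfolding eg using Comp_assoc[OF dex g2 cYZ] .
    also have "(d \<boxtimes> e) \<boxtimes> x = d \<boxtimes> (e \<boxtimes> x)"
      using d e x by (simp add: TensorA_assoc hom_Arr)
    also have "(\<I> ?K \<boxtimes> \<epsilon> X Y) \<cdot> (d \<boxtimes> (e \<boxtimes> x)) = d \<boxtimes> (\<epsilon> X Y \<cdot> (e \<boxtimes> x))"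
      using Comp_Tensor[OF d Ident_hom[OF K] ex cXY] d by (simp add: Ident_Comp)
    finally show ?thesis .
  qed
  define v where "v = \<epsilon> X Y \<cdot> (e \<boxtimes> \<I> X)"
  have v: "v \<in> hom C (E \<otimes> X) Y"
    unfolding v_def using Tensor_hom[OF e Ident_hom[OF X]] cXY by (rule Comp_hom)
  have vA: "v \<boxtimes> \<I> ?A \<in> hom C ((E \<otimes> X) \<otimes> ?A) (Y \<otimes> ?A)" using v Ident_hom[OF A] by (rule Tensor_hom)
  define w where "w = \<epsilon> Y Z \<cdot> (d \<boxtimes> \<I> Y)"
  have dY: "d \<boxtimes> \<I> Y \<in> hom C (D \<otimes> Y) (?K \<otimes> Y)" using d Ident_hom[OF Y] by (rule Tensor_hom)
  have w: "w \<in> hom C (D \<otimes> Y) Z" unfolding w_def using dY cYZ by (rule Comp_hom)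
  have wA: "w \<boxtimes> \<I> ?A \<in> hom C ((D \<otimes> Y) \<otimes> ?A) (Z \<otimes> ?A)" using w Ident_hom[OF A] by (rule Tensor_hom)
  have Dv: "\<I> D \<boxtimes> v \<in> hom C (D \<otimes> E \<otimes> X) (D \<otimes> Y)" using Ident_hom[OF D] v by (rule Tensor_hom)
  have DvA: "\<I> D \<boxtimes> (v \<boxtimes> \<I> ?A) \<in> hom C (D \<otimes> (E \<otimes> X) \<otimes> ?A) (D \<otimes> Y \<otimes> ?A)"
    using Ident_hom[OF D] vA by (rule Tensor_hom)
  have ds: "d \<boxtimes> s \<in> hom C (D \<otimes> Y \<otimes> ?A) (?K \<otimes> Y)" using d s by (rule Tensor_hom)
  have wA': "w \<boxtimes> \<I> ?A \<in> hom C (D \<otimes> Y \<otimes> ?A) (Z \<otimes> ?A)"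
    using wA by (simp add: TensorO_assoc D Y A)
  have wv: "w \<cdot> (\<I> D \<boxtimes> v) = \<epsilon> X Z \<cdot> (k \<boxtimes> \<I> X)"
  proof -
    have "w \<cdot> (\<I> D \<boxtimes> v) = \<epsilon> Y Z \<cdot> (d \<boxtimes> \<I> Y) \<cdot> (\<I> D \<boxtimes> v)"
      unfolding w_def using Comp_assoc[OF Dv dY cYZ] .
    also have "(d \<boxtimes> \<I> Y) \<cdot> (\<I> D \<boxtimes> v) = d \<boxtimes> v"
      using Comp_Tensor[OF Ident_hom[OF D] d v Ident_hom[OF Y]] d v by (simp add: Ident_Comp Comp_Ident)
    finally show ?thesis using app[OF Ident_hom[OF X]] by (simp add: v_def)
  qed
  have "\<epsilon> X Z \<cdot> (k \<boxtimes> r) = \<epsilon> Y Z \<cdot> (d \<boxtimes> (s \<cdot> (v \<boxtimes> \<I> ?A)))"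
    using app[OF r] ep by (simp add: v_def)
  also have "d \<boxtimes> (s \<cdot> (v \<boxtimes> \<I> ?A)) = (d \<boxtimes> s) \<cdot> (\<I> D \<boxtimes> (v \<boxtimes> \<I> ?A))"
    using Comp_Tensor[OF Ident_hom[OF D] d vA s] d by (simp add: Comp_Ident)
  also have "\<epsilon> Y Z \<cdot> \<dots> = (\<epsilon> Y Z \<cdot> (d \<boxtimes> s)) \<cdot> (\<I> D \<boxtimes> (v \<boxtimes> \<I> ?A))"
    using Comp_assoc[OF DvA ds cYZ] by simp
  also have "\<dots> = t \<cdot> (w \<boxtimes> \<I> ?A) \<cdot> (\<I> D \<boxtimes> (v \<boxtimes> \<I> ?A))"
    unfolding dp w_def[symmetric] using Comp_assoc[OF DvA wA' t] .
  also have "\<I> D \<boxtimes> (v \<boxtimes> \<I> ?A) = (\<I> D \<boxtimes> v) \<boxtimes> \<I> ?A"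
    using TensorA_assoc[OF hom_Arr[OF Ident_hom[OF D]] hom_Arr[OF v] hom_Arr[OF Ident_hom[OF A]]] by simp
  also have "(w \<boxtimes> \<I> ?A) \<cdot> ((\<I> D \<boxtimes> v) \<boxtimes> \<I> ?A) = (\<epsilon> X Z \<cdot> (k \<boxtimes> \<I> X)) \<boxtimes> \<I> ?A"
    using Comp_Tensor[OF Dv w Ident_hom[OF A] Ident_hom[OF A]]
    by (simp add: wv Comp_Ident[OF Ident_hom[OF A]])
  finally have "\<epsilon> X Z \<cdot> (k \<boxtimes> r) = t \<cdot> ((\<epsilon> X Z \<cdot> (k \<boxtimes> \<I> X)) \<boxtimes> \<I> ?A)" .
  from mod_eq_lift[OF M P A k[unfolded XYZ] this[unfolded XYZ rst]] show ?thesis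
    unfolding k_def XYZ DE de .
qed

end

end

theory Submission
  imports Defs
begin

text \<open>
  Write \<open>ev\<close> for the evaluation \<open>[A,A]\<^sub>A \<otimes> A \<rightarrow> A\<close>. By the universal properties of the adjunction
  and of the equalizer, it is universal among the morphisms \<open>W \<otimes> A \<rightarrow> A\<close> which are right \<open>A\<close>-linear
  in the second factor. The multiplication of \<open>A\<close> is such a morphism, hence corresponds to some
  \<open>f : A \<rightarrow> [A,A]\<^sub>A\<close> (left multiplication). Its inverse is evaluation at the unit of \<open>A\<close>. Every
  identity between morphisms into \<open>[A,A]\<^sub>A\<close> is checked after evaluation.
\<close>

section \<open>Interchange law and isomorphisms of algebras\<close>

context strict_monoidal_category
begin

text \<open>The interchange law with \<open>h\<close> read as \<open>\<I> W \<cdot> h\<close> or as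
  \<open>h \<cdot> \<I> V\<close>; the two versions differ in which factor keeps
  \<open>h\<close>.\<close>

lemma Tensor_Comp_left:
  assumes "f \<in> hom C X Y" "g \<in> hom C Y Z" "h \<in> hom C V W"
  shows "(g \<cdot> f) \<boxtimes> h = (g \<boxtimes> \<I> W) \<cdot> (f \<boxtimes> h)" "(g \<cdot> f) \<boxtimes> h = (g \<boxtimes> h) \<cdot> (f \<boxtimes> \<I> V)"
  using Tensor_Comp[OF assms(1,2) assms(3) Ident_hom[OF hom_Ob(2)[OF assms(3)]]]
    Tensor_Comp[OF assms(1,2) Ident_hom[OF hom_Ob(1)[OF assms(3)]] assms(3)]
  unfolding Ident_Comp[OF assms(3)] Comp_Ident[OF assms(3)] .

lemma Tensor_Comp_right:
  assumes "f \<in> hom C X Y" "g \<in> hom C Y Z" "h \<in> hom C V W"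
  shows "h \<boxtimes> (g \<cdot> f) = (\<I> W \<boxtimes> g) \<cdot> (h \<boxtimes> f)" "h \<boxtimes> (g \<cdot> f) = (h \<boxtimes> g) \<cdot> (\<I> V \<boxtimes> f)"
  using Tensor_Comp[OF assms(3) Ident_hom[OF hom_Ob(2)[OF assms(3)]] assms(1,2)]
    Tensor_Comp[OF Ident_hom[OF hom_Ob(1)[OF assms(3)]] assms(3) assms(1,2)]
  unfolding Ident_Comp[OF assms(3)] Comp_Ident[OF assms(3)] .

text \<open>The inverse of an algebra morphism automatically respects multiplication and unit, so
  these need checking for \<open>f\<close> only.\<close>

lemma isomorphic_algebrasI:
  assumes A: "is_algebra C A" and B: "is_algebra C B" and f: "is_algebra_hom C A B f"
    and g: "g \<in> hom C (alg_obj B) (alg_obj A)"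
    and gf: "g \<cdot> f = \<I> (alg_obj A)" and fg: "f \<cdot> g = \<I> (alg_obj B)"
  shows "isomorphic_algebras C A B"
proof -
  let ?X = "alg_obj A" and ?Y = "alg_obj B" and ?m = "alg_mult A" and ?n = "alg_mult B"
  have m: "?m \<in> hom C (?X \<otimes> ?X) ?X" and u: "alg_unit A \<in> hom C \<one> ?X"
    using A by (simp_all add: is_algebra_def Let_def)
  have Y: "?Y \<in> Ob C" and n: "?n \<in> hom C (?Y \<otimes> ?Y) ?Y"
    using B by (simp_all add: is_algebra_def Let_def)
  have f': "f \<in> hom C ?X ?Y" and fm: "f \<cdot> ?m = ?n \<cdot> (f \<boxtimes> f)" and fu: "f \<cdot> alg_unit A = alg_unit B"
    using f by (simp_all add: is_algebra_hom_def)
  have ff: "f \<boxtimes> f \<in> hom C (?X \<otimes> ?X) (?Y \<otimes> ?Y)" and gg: "g \<boxtimes> g \<in> hom C (?Y \<otimes> ?Y) (?X \<otimes> ?X)"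
    using f' g by (simp_all add: Tensor_hom)
  \<comment> \<open>The inserted factor is the identity because \<open>f \<cdot> g\<close> is;
    multiplicativity of \<open>f\<close> then expresses \<open>?n\<close> through
    \<open>?m\<close>.\<close>
  have "?n = ?n \<cdot> ((f \<boxtimes> f) \<cdot> (g \<boxtimes> g))"
    using n Comp_Tensor[OF g f' g f'] by (simp add: fg Tensor_Ident Y Comp_Ident)
  also have "\<dots> = f \<cdot> (?m \<cdot> (g \<boxtimes> g))"
    using Comp_assoc[OF gg ff n] Comp_assoc[OF gg m f'] fm by simp
  finally have "g \<cdot> ?n = (g \<cdot> f) \<cdot> (?m \<cdot> (g \<boxtimes> g))"
    using Comp_assoc[OF Comp_hom[OF gg m] f' g] by simp
  then have "g \<cdot> ?n = ?m \<cdot> (g \<boxtimes> g)"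
    unfolding gf using Ident_Comp[OF Comp_hom[OF gg m]] by simp
  moreover have "g \<cdot> alg_unit B = alg_unit A"
    using Comp_assoc[OF u f' g] u by (simp add: fu gf Ident_Comp)
  ultimately show ?thesis
    using A B f g gf fg unfolding isomorphic_algebras_def is_algebra_hom_def by blast
qed

end

text \<open>Does for \<open>mod_hom\<close> what the counit does for \<open>IHom\<close>. Working
  with it keeps transposes and the inclusion \<open>mod_eq\<close> out of the later
  computations.\<close>

definition mod_ev ::
  "('o, 'a, 'x) closed_monoidal_eq_scheme \<Rightarrow> ('o, 'a) alg \<Rightarrow> ('o, 'a) rmod \<Rightarrow> ('o, 'a) rmod \<Rightarrow> 'a" where
  "mod_ev C A M N =
     \<epsilon>\<^bsub>C\<^esub> (mod_obj M) (mod_obj N) \<cdot>\<^bsub>C\<^esub> (mod_eq C A M N \<boxtimes>\<^bsub>C\<^esub> \<I>\<^bsub>C\<^esub> (mod_obj M))"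

context right_closed_monoidal_category
begin

text \<open>\<open>\<gamma>\<close> is a transpose, so evaluating it undoes the transposition and
  leaves two nested evaluations. The arbitrary \<open>d\<close>, \<open>e\<close>, \<open>x\<close>
  act as generalized elements: composing first and then applying to \<open>x\<close> gives
  \<open>d(e(x))\<close>.\<close>

lemma counit_ihom_comp:
  assumes X: "X \<in> Ob C" and Y: "Y \<in> Ob C" and Z: "Z \<in> Ob C"
    and d: "d \<in> hom C V (IHom C Y Z)" and e: "e \<in> hom C W (IHom C X Y)" and x: "x \<in> hom C U X"
  shows "\<epsilon> X Z \<cdot> ((\<gamma> X Y Z \<cdot> (d \<boxtimes> e)) \<boxtimes> x) = \<epsilon> Y Z \<cdot> (d \<boxtimes> (\<epsilon> X Y \<cdot> (e \<boxtimes> x)))"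
    and "\<gamma> X Y Z \<in> hom C (IHom C Y Z \<otimes> IHom C X Y) (IHom C X Z)"
proof -
  let ?H = "IHom C X Y" and ?K = "IHom C Y Z"
  have H: "?H \<in> Ob C" and K: "?K \<in> Ob C" using X Y Z by (simp_all add: IHom_Ob)
  have cXY: "\<epsilon> X Y \<in> hom C (?H \<otimes> X) Y" and cYZ: "\<epsilon> Y Z \<in> hom C (?K \<otimes> Y) Z"
    and cXZ: "\<epsilon> X Z \<in> hom C (IHom C X Z \<otimes> X) Z"
    using X Y Z by (simp_all add: counit_hom)
  have g2: "\<I> ?K \<boxtimes> \<epsilon> X Y \<in> hom C ((?K \<otimes> ?H) \<otimes> X) (?K \<otimes> Y)"
    using Tensor_hom[OF Ident_hom[OF K] cXY] by (simp add: TensorO_assoc K H X)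
  note T = Tensor_Ob[OF K H] X Comp_hom[OF g2 cYZ]
  show g: "\<gamma> X Y Z \<in> hom C (?K \<otimes> ?H) (IHom C X Z)"
    unfolding ihom_comp_def using T by (rule Transpose_hom)
  have eg: "\<epsilon> X Z \<cdot> (\<gamma> X Y Z \<boxtimes> \<I> X) = \<epsilon> Y Z \<cdot> (\<I> ?K \<boxtimes> \<epsilon> X Y)"
    unfolding ihom_comp_def using T by (rule counit_Transpose)
  have de: "d \<boxtimes> e \<in> hom C (V \<otimes> W) (?K \<otimes> ?H)" using d e by (rule Tensor_hom)
  have dex: "(d \<boxtimes> e) \<boxtimes> x \<in> hom C ((V \<otimes> W) \<otimes> U) ((?K \<otimes> ?H) \<otimes> X)" using de x by (rule Tensor_hom)
  have ex: "e \<boxtimes> x \<in> hom C (W \<otimes> U) (?H \<otimes> X)" using e x by (rule Tensor_hom)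
  have "\<epsilon> X Z \<cdot> ((\<gamma> X Y Z \<cdot> (d \<boxtimes> e)) \<boxtimes> x) = (\<epsilon> X Z \<cdot> (\<gamma> X Y Z \<boxtimes> \<I> X)) \<cdot> ((d \<boxtimes> e) \<boxtimes> x)"
    using Tensor_Comp_left(1)[OF de g x] Comp_assoc[OF dex Tensor_hom[OF g Ident_hom[OF X]] cXZ]
    by simp
  also have "\<dots> = \<epsilon> Y Z \<cdot> ((\<I> ?K \<boxtimes> \<epsilon> X Y) \<cdot> (d \<boxtimes> (e \<boxtimes> x)))"
    unfolding eg using Comp_assoc[OF dex g2 cYZ] d e x by (simp add: TensorA_assoc hom_Arr)
  also have "\<dots> = \<epsilon> Y Z \<cdot> (d \<boxtimes> (\<epsilon> X Y \<cdot> (e \<boxtimes> x)))"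
    using Tensor_Comp_right(1)[OF ex cXY d] by simp
  finally show "\<epsilon> X Z \<cdot> ((\<gamma> X Y Z \<cdot> (d \<boxtimes> e)) \<boxtimes> x) = \<epsilon> Y Z \<cdot> (d \<boxtimes> (\<epsilon> X Y \<cdot> (e \<boxtimes> x)))" .
qed

end

section \<open>Evaluation of module morphisms and its universal property\<close>

context right_closed_monoidal_category_with_equalizers
begin

text \<open>The third clause is the bridge by which facts about the counit carry over to
  \<open>mod_ev\<close>.\<close>

lemma mod_ev_hom:
  assumes M: "is_right_module C A M" and N: "is_right_module C A N" and A: "alg_obj A \<in> Ob C"
  shows "mod_ev C A M N \<in> hom C (mod_hom C A M N \<otimes> mod_obj M) (mod_obj N)"
    and "\<lbrakk>a \<in> hom C V (mod_hom C A M N); x \<in> hom C W (mod_obj M)\<rbrakk>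
      \<Longrightarrow> mod_ev C A M N \<cdot> (a \<boxtimes> x) \<in> hom C (V \<otimes> W) (mod_obj N)"
    and "\<lbrakk>a \<in> hom C V (mod_hom C A M N); x \<in> hom C W (mod_obj M)\<rbrakk>
      \<Longrightarrow> mod_ev C A M N \<cdot> (a \<boxtimes> x) = \<epsilon> (mod_obj M) (mod_obj N) \<cdot> ((mod_eq C A M N \<cdot> a) \<boxtimes> x)"
proof -
  have X: "mod_obj M \<in> Ob C" and Y: "mod_obj N \<in> Ob C"
    using M N by (simp_all add: is_right_module_def Let_def)
  note e = mod_eq_hom[OF assms] and i = Ident_hom[OF X] and c = counit_hom[OF X Y]
  note t = Tensor_hom[OF e i]
  show ev: "mod_ev C A M N \<in> hom C (mod_hom C A M N \<otimes> mod_obj M) (mod_obj N)"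
    unfolding mod_ev_def using t c by (rule Comp_hom)
  assume a: "a \<in> hom C V (mod_hom C A M N)" and x: "x \<in> hom C W (mod_obj M)"
  show "mod_ev C A M N \<cdot> (a \<boxtimes> x) \<in> hom C (V \<otimes> W) (mod_obj N)"
    using Tensor_hom[OF a x] ev by (rule Comp_hom)
  show "mod_ev C A M N \<cdot> (a \<boxtimes> x) = \<epsilon> (mod_obj M) (mod_obj N) \<cdot> ((mod_eq C A M N \<cdot> a) \<boxtimes> x)"
    unfolding mod_ev_def
    using Comp_assoc[OF Tensor_hom[OF a x] t c] Tensor_Comp_left(1)[OF a e x] by simp
qed

text \<open>In generalized elements, \<open>a(x b) = a(x) b\<close>. This is the equalizing
  condition \<open>mod_eq_pointwise\<close> precomposed with
  \<open>a \<boxtimes> x \<boxtimes> b\<close>.\<close>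

lemma mod_ev_act:
  assumes M: "is_right_module C A M" and N: "is_right_module C A N" and A: "alg_obj A \<in> Ob C"
    and a: "a \<in> hom C V (mod_hom C A M N)" and x: "x \<in> hom C W (mod_obj M)"
    and b: "b \<in> hom C U (alg_obj A)"
  shows "mod_ev C A M N \<cdot> (a \<boxtimes> (mod_act M \<cdot> (x \<boxtimes> b))) = mod_act N \<cdot> ((mod_ev C A M N \<cdot> (a \<boxtimes> x)) \<boxtimes> b)"
proof -
  let ?X = "mod_obj M" and ?Y = "mod_obj N" and ?A = "alg_obj A" and ?H = "mod_hom C A M N"
  let ?ev = "mod_ev C A M N" and ?e = "mod_eq C A M N"
  have X: "?X \<in> Ob C" and r: "mod_act M \<in> hom C (?X \<otimes> ?A) ?X"
    and Y: "?Y \<in> Ob C" and s: "mod_act N \<in> hom C (?Y \<otimes> ?A) ?Y"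
    using M N by (simp_all add: is_right_module_def Let_def)
  note e = mod_eq_hom[OF M N A] and ev = mod_ev_hom(1)[OF M N A]
  have H: "?H \<in> Ob C" using e hom_Ob by blast
  have xb: "x \<boxtimes> b \<in> hom C (W \<otimes> U) (?X \<otimes> ?A)" using x b by (rule Tensor_hom)
  have axb: "a \<boxtimes> (x \<boxtimes> b) \<in> hom C (V \<otimes> W \<otimes> U) (?H \<otimes> ?X \<otimes> ?A)" using a xb by (rule Tensor_hom)
  have evA: "?ev \<boxtimes> \<I> ?A \<in> hom C (?H \<otimes> ?X \<otimes> ?A) (?Y \<otimes> ?A)"
    using Tensor_hom[OF ev Ident_hom[OF A]] by (simp add: TensorO_assoc H X A)
  have "?ev \<cdot> (a \<boxtimes> (mod_act M \<cdot> (x \<boxtimes> b))) = \<epsilon> ?X ?Y \<cdot> ((?e \<cdot> a) \<boxtimes> (mod_act M \<cdot> (x \<boxtimes> b)))"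
    using a Comp_hom[OF xb r] by (rule mod_ev_hom(3)[OF M N A])
  also have "\<dots> = (\<epsilon> ?X ?Y \<cdot> (?e \<boxtimes> mod_act M)) \<cdot> (a \<boxtimes> (x \<boxtimes> b))"
    using Tensor_Comp[OF a e xb r] Comp_assoc[OF axb Tensor_hom[OF e r] counit_hom[OF X Y]] by simp
  also have "\<dots> = mod_act N \<cdot> ((?ev \<boxtimes> \<I> ?A) \<cdot> (a \<boxtimes> (x \<boxtimes> b)))"
    unfolding mod_eq_pointwise[OF M N A] mod_ev_def[symmetric] using axb evA s by (rule Comp_assoc)
  also have "a \<boxtimes> (x \<boxtimes> b) = (a \<boxtimes> x) \<boxtimes> b" using a x b by (simp add: TensorA_assoc hom_Arr)
  also have "(?ev \<boxtimes> \<I> ?A) \<cdot> \<dots> = (?ev \<cdot> (a \<boxtimes> x)) \<boxtimes> b"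
    using Tensor_Comp_left(1)[OF Tensor_hom[OF a x] ev b] by simp
  finally show ?thesis .
qed

text \<open>A morphism into \<open>[M,N]\<close> is recovered by transposing its evaluation, and a
  morphism into \<open>mod_hom C A M N\<close> is determined by its composite with the equalizer
  \<open>mod_eq\<close>.\<close>

lemma mod_ev_ext:
  assumes M: "is_right_module C A M" and N: "is_right_module C A N" and A: "alg_obj A \<in> Ob C"
    and a: "a \<in> hom C V (mod_hom C A M N)" and b: "b \<in> hom C V (mod_hom C A M N)"
    and eq: "mod_ev C A M N \<cdot> (a \<boxtimes> \<I> (mod_obj M)) = mod_ev C A M N \<cdot> (b \<boxtimes> \<I> (mod_obj M))"
  shows "a = b"
proof -
  let ?X = "mod_obj M" and ?Y = "mod_obj N" and ?A = "alg_obj A" and ?e = "mod_eq C A M N"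
  have X: "?X \<in> Ob C" and r: "mod_act M \<in> hom C (?X \<otimes> ?A) ?X" and Y: "?Y \<in> Ob C"
    using M N by (simp_all add: is_right_module_def Let_def)
  note e = mod_eq_hom[OF M N A] and ev = mod_ev_hom[OF M N A] and i = Ident_hom[OF X]
  have ea: "?e \<cdot> a \<in> hom C V (IHom C ?X ?Y)" and eb: "?e \<cdot> b \<in> hom C V (IHom C ?X ?Y)"
    using a b e by (auto intro: Comp_hom)
  have "?e \<cdot> a = ?e \<cdot> b"
    using eq unfolding ev(3)[OF a i] ev(3)[OF b i]
    using Transpose_counit_Comp[OF ea X Y] Transpose_counit_Comp[OF eb X Y] by metis
  \<comment> \<open>\<open>mod_eq_lift\<close> yields uniqueness only for morphisms known to be
    pointwise linear, so linearity of \<open>?e \<cdot> a\<close> is established by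
    \<open>mod_ev_act\<close> at identities.\<close>
  moreover have "\<epsilon> ?X ?Y \<cdot> ((?e \<cdot> a) \<boxtimes> mod_act M) =
      mod_act N \<cdot> ((\<epsilon> ?X ?Y \<cdot> ((?e \<cdot> a) \<boxtimes> \<I> ?X)) \<boxtimes> \<I> ?A)"
    using mod_ev_act[OF M N A a i Ident_hom[OF A]]
    unfolding Tensor_Ident[OF X A] Comp_Ident[OF r] ev(3)[OF a i] ev(3)[OF a r] .
  ultimately show ?thesis
    using mod_eq_lift[OF M N A ea] a b by metis
qed

text \<open>The transpose of \<open>f\<close> evaluates back to \<open>f\<close>, so
  \<open>lin\<close> says precisely that this transpose is pointwise linear and hence factors
  through the equalizer.\<close>

lemma mod_ev_lift:
  assumes M: "is_right_module C A M" and N: "is_right_module C A N" and A: "alg_obj A \<in> Ob C"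
    and W: "W \<in> Ob C" and f: "f \<in> hom C (W \<otimes> mod_obj M) (mod_obj N)"
    and lin: "f \<cdot> (\<I> W \<boxtimes> mod_act M) = mod_act N \<cdot> (f \<boxtimes> \<I> (alg_obj A))"
  obtains h where "h \<in> hom C W (mod_hom C A M N)"
    and "mod_ev C A M N \<cdot> (h \<boxtimes> \<I> (mod_obj M)) = f"
proof -
  let ?X = "mod_obj M" and ?Y = "mod_obj N" and ?A = "alg_obj A"
  have X: "?X \<in> Ob C" and r: "mod_act M \<in> hom C (?X \<otimes> ?A) ?X" and Y: "?Y \<in> Ob C"
    using M N by (simp_all add: is_right_module_def Let_def)
  let ?k = "Transpose C W ?X ?Y f"
  have k: "?k \<in> hom C W (IHom C ?X ?Y)" using W X f by (rule Transpose_hom)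
  have ek: "\<epsilon> ?X ?Y \<cdot> (?k \<boxtimes> \<I> ?X) = f" using W X f by (rule counit_Transpose)
  have "?k \<boxtimes> mod_act M = (?k \<boxtimes> \<I> ?X) \<cdot> (\<I> W \<boxtimes> mod_act M)"
    using Tensor_Comp_right(2)[OF r Ident_hom[OF X] k] r by (simp add: Ident_Comp)
  then have "\<epsilon> ?X ?Y \<cdot> (?k \<boxtimes> mod_act M) = f \<cdot> (\<I> W \<boxtimes> mod_act M)"
    using Comp_assoc[OF Tensor_hom[OF Ident_hom[OF W] r] Tensor_hom[OF k Ident_hom[OF X]]
        counit_hom[OF X Y]] ek by simp
  then obtain h where h: "h \<in> hom C W (mod_hom C A M N)" and eh: "mod_eq C A M N \<cdot> h = ?k"
    using mod_eq_lift[OF M N A k] lin ek by auto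
  show thesis
    using that[OF h] mod_ev_hom(3)[OF M N A h Ident_hom[OF X]] eh ek by simp
qed

section \<open>Composition, identities and the endomorphism algebra\<close>

lemma mod_ev_mod_comp:
  assumes M: "is_right_module C A M" and N: "is_right_module C A N" and P: "is_right_module C A P"
    and A: "alg_obj A \<in> Ob C"
  shows "mod_comp C A M N P \<in> hom C (mod_hom C A N P \<otimes> mod_hom C A M N) (mod_hom C A M P)"
    and "\<lbrakk>a \<in> hom C V (mod_hom C A N P); b \<in> hom C W (mod_hom C A M N); x \<in> hom C U (mod_obj M)\<rbrakk>
      \<Longrightarrow> mod_ev C A M P \<cdot> ((mod_comp C A M N P \<cdot> (a \<boxtimes> b)) \<boxtimes> x) =
        mod_ev C A N P \<cdot> (a \<boxtimes> (mod_ev C A M N \<cdot> (b \<boxtimes> x)))"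
proof -
  let ?X = "mod_obj M" and ?Y = "mod_obj N" and ?Z = "mod_obj P"
  have X: "?X \<in> Ob C" and Y: "?Y \<in> Ob C" and Z: "?Z \<in> Ob C"
    using M N P by (simp_all add: is_right_module_def Let_def)
  let ?c = "mod_comp C A M N P" and ?d = "mod_eq C A N P" and ?e = "mod_eq C A M N"
  \<comment> \<open>\<open>mod_comp\<close> is a definite description; its defining equation becomes
    available through unique existence.\<close>
  note C = theI'[OF mod_comp_unique[OF assms], folded mod_comp_def]
  show c: "?c \<in> hom C (mod_hom C A N P \<otimes> mod_hom C A M N) (mod_hom C A M P)"
    using C by blast
  have ec: "mod_eq C A M P \<cdot> ?c = \<gamma> ?X ?Y ?Z \<cdot> (?d \<boxtimes> ?e)" using C by blast
  assume a: "a \<in> hom C V (mod_hom C A N P)" and b: "b \<in> hom C W (mod_hom C A M N)"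
    and x: "x \<in> hom C U ?X"
  note d = mod_eq_hom[OF N P A] and e = mod_eq_hom[OF M N A]
  note ab = Tensor_hom[OF a b] and da = Comp_hom[OF a d] and eb = Comp_hom[OF b e]
  note g = counit_ihom_comp[OF X Y Z da eb x]
  have "mod_eq C A M P \<cdot> (?c \<cdot> (a \<boxtimes> b)) = (\<gamma> ?X ?Y ?Z \<cdot> (?d \<boxtimes> ?e)) \<cdot> (a \<boxtimes> b)"
    using Comp_assoc[OF ab c mod_eq_hom[OF M P A]] ec by simp
  also have "\<dots> = \<gamma> ?X ?Y ?Z \<cdot> ((?d \<cdot> a) \<boxtimes> (?e \<cdot> b))"
    using Comp_assoc[OF ab Tensor_hom[OF d e] g(2)] Comp_Tensor[OF a d b e] by simp
  finally show "mod_ev C A M P \<cdot> ((?c \<cdot> (a \<boxtimes> b)) \<boxtimes> x) =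
      mod_ev C A N P \<cdot> (a \<boxtimes> (mod_ev C A M N \<cdot> (b \<boxtimes> x)))"
    using g(1) mod_ev_hom(3)[OF M P A Comp_hom[OF ab c] x] mod_ev_hom(3)[OF M N A b x]
      mod_ev_hom(3)[OF N P A a mod_ev_hom(2)[OF M N A b x]] by simp
qed

text \<open>\<open>\<kappa>\<close> is the transpose of an identity, so evaluating it returns that
  identity; interchange extends this to every \<open>x\<close>.\<close>

lemma mod_ev_mod_id:
  assumes M: "is_right_module C A M" and A: "alg_obj A \<in> Ob C"
  shows "mod_id C A M \<in> hom C \<one> (mod_hom C A M M)"
    and "x \<in> hom C W (mod_obj M) \<Longrightarrow> mod_ev C A M M \<cdot> (mod_id C A M \<boxtimes> x) = x"
proof -
  let ?X = "mod_obj M" and ?j = "mod_id C A M" and ?ev = "mod_ev C A M M"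
  have X: "?X \<in> Ob C" using M by (simp add: is_right_module_def Let_def)
  note C = theI'[OF mod_id_unique[OF assms], folded mod_id_def]
  show j: "?j \<in> hom C \<one> (mod_hom C A M M)" using C by blast
  \<comment> \<open>By strictness the identity of \<open>?X\<close> is also a morphism out of
    \<open>\<one> \<otimes> ?X\<close>, so it can be transposed as it stands.\<close>
  have i: "\<I> ?X \<in> hom C (\<one> \<otimes> ?X) ?X" using Ident_hom[OF X] by (simp add: Unit_TensorO X)
  have ej: "?ev \<cdot> (?j \<boxtimes> \<I> ?X) = \<I> ?X"
    using mod_ev_hom(3)[OF M M A j Ident_hom[OF X]] C counit_Transpose[OF Unit_Ob X i]
    by (simp add: ihom_id_def)
  assume x: "x \<in> hom C W ?X"
  have "?j \<boxtimes> x = (?j \<boxtimes> \<I> ?X) \<cdot> (\<I> \<one> \<boxtimes> x)"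
    using Tensor_Comp_right(2)[OF x Ident_hom[OF X] j] x by (simp add: Ident_Comp)
  also have "\<I> \<one> \<boxtimes> x = x" using x by (simp add: Unit_TensorA hom_Arr)
  finally have "?j \<boxtimes> x = (?j \<boxtimes> \<I> ?X) \<cdot> x" .
  moreover have "?j \<boxtimes> \<I> ?X \<in> hom C ?X (mod_hom C A M M \<otimes> ?X)"
    using Tensor_hom[OF j Ident_hom[OF X]] by (simp add: Unit_TensorO X)
  ultimately show "?ev \<cdot> (?j \<boxtimes> x) = x"
    using Comp_assoc[OF x _ mod_ev_hom(1)[OF M M A], symmetric] ej x by (simp add: Ident_Comp)
qed

text \<open>By \<open>mod_ev_ext\<close> each law may be checked after evaluation, where
  \<open>mod_comp\<close> becomes nested application and \<open>mod_id\<close> disappears.\<close>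

lemma is_algebra_mod_end:
  assumes M: "is_right_module C A M" and A: "alg_obj A \<in> Ob C"
  shows "is_algebra C (mod_end C A M)"
proof -
  let ?X = "mod_obj M" and ?E = "mod_hom C A M M" and ?ev = "mod_ev C A M M"
  let ?c = "mod_comp C A M M M" and ?j = "mod_id C A M"
  have X: "?X \<in> Ob C" using M by (simp add: is_right_module_def Let_def)
  note c = mod_ev_mod_comp[OF M M M A] and j = mod_ev_mod_id[OF M A] and ev = mod_ev_hom[OF M M A]
  have E: "?E \<in> Ob C" using j(1) hom_Ob by blast
  note iE = Ident_hom[OF E] and iX = Ident_hom[OF X] and EE = Tensor_Ob[OF E E]
  have ev_id: "?ev \<cdot> (\<I> ?E \<boxtimes> \<I> ?X) = ?ev"
    using ev(1) by (simp add: Tensor_Ident E X Comp_Ident)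
  \<comment> \<open>With identities as generalized elements, the composition rule describes
    \<open>?c\<close> itself.\<close>
  have ev_comp: "?ev \<cdot> (?c \<boxtimes> x) = ?ev \<cdot> (\<I> ?E \<boxtimes> (?ev \<cdot> (\<I> ?E \<boxtimes> x)))" if x: "x \<in> hom C U ?X" for x U
    using c(2)[OF iE iE x] by (simp add: Tensor_Ident E Comp_Ident[OF c(1)])
  have cE: "?c \<boxtimes> \<I> ?E \<in> hom C (?E \<otimes> ?E \<otimes> ?E) (?E \<otimes> ?E)"
    using Tensor_hom[OF c(1) iE] by (simp add: TensorO_assoc E)
  have assoc: "?c \<cdot> (?c \<boxtimes> \<I> ?E) = ?c \<cdot> (\<I> ?E \<boxtimes> ?c)"
  proof (rule mod_ev_ext[OF M M A])
    show "?c \<cdot> (?c \<boxtimes> \<I> ?E) \<in> hom C (?E \<otimes> ?E \<otimes> ?E) ?E" using cE c(1) by (rule Comp_hom)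
    show "?c \<cdot> (\<I> ?E \<boxtimes> ?c) \<in> hom C (?E \<otimes> ?E \<otimes> ?E) ?E"
      using Tensor_hom[OF iE c(1)] c(1) by (rule Comp_hom)
    show "?ev \<cdot> ((?c \<cdot> (?c \<boxtimes> \<I> ?E)) \<boxtimes> \<I> ?X) = ?ev \<cdot> ((?c \<cdot> (\<I> ?E \<boxtimes> ?c)) \<boxtimes> \<I> ?X)"
      \<comment> \<open>Both bracketings unfold to the same three nested evaluations.\<close>
      unfolding c(2)[OF c(1) iE iX] c(2)[OF iE c(1) iX] ev_comp[OF iX]
        ev_comp[OF ev(2)[OF iE iX]] ..
  qed
  have unit_left: "?c \<cdot> (?j \<boxtimes> \<I> ?E) = \<I> ?E"
  proof (rule mod_ev_ext[OF M M A _ iE])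
    show "?c \<cdot> (?j \<boxtimes> \<I> ?E) \<in> hom C ?E ?E"
      using Comp_hom[OF Tensor_hom[OF j(1) iE] c(1)] by (simp add: Unit_TensorO E)
    show "?ev \<cdot> ((?c \<cdot> (?j \<boxtimes> \<I> ?E)) \<boxtimes> \<I> ?X) = ?ev \<cdot> (\<I> ?E \<boxtimes> \<I> ?X)"
      unfolding c(2)[OF j(1) iE iX] using ev(2)[OF iE iX] by (rule j(2))
  qed
  have unit_right: "?c \<cdot> (\<I> ?E \<boxtimes> ?j) = \<I> ?E"
  proof (rule mod_ev_ext[OF M M A _ iE])
    show "?c \<cdot> (\<I> ?E \<boxtimes> ?j) \<in> hom C ?E ?E"
      using Comp_hom[OF Tensor_hom[OF iE j(1)] c(1)] by (simp add: TensorO_Unit E)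
    show "?ev \<cdot> ((?c \<cdot> (\<I> ?E \<boxtimes> ?j)) \<boxtimes> \<I> ?X) = ?ev \<cdot> (\<I> ?E \<boxtimes> \<I> ?X)"
      unfolding c(2)[OF iE j(1) iX] j(2)[OF iX] ..
  qed
  show ?thesis
    using E c(1) j(1) assoc unit_left unit_right by (simp add: is_algebra_def mod_end_def)
qed

section \<open>Left multiplication as an isomorphism of algebras\<close>

theorem isomorphic_algebras_mod_end_regular:
  assumes "is_algebra C A"
  shows "isomorphic_algebras C A (mod_end C A (regular_module A))"
proof -
  define X m u where Xmu: "X = alg_obj A" "m = alg_mult A" "u = alg_unit A"
  define M where "M = regular_module A"
  have Mr: "mod_obj M = X" "mod_act M = m" by (simp_all add: M_def regular_module_def Xmu)
  have X: "X \<in> Ob C" and m: "m \<in> hom C (X \<otimes> X) X" and u: "u \<in> hom C \<one> X"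
    and mm: "m \<cdot> (m \<boxtimes> \<I> X) = m \<cdot> (\<I> X \<boxtimes> m)"
    and mu: "m \<cdot> (u \<boxtimes> \<I> X) = \<I> X" "m \<cdot> (\<I> X \<boxtimes> u) = \<I> X"
    using assms by (simp_all add: is_algebra_def Let_def Xmu)
  have M: "is_right_module C A M"
    unfolding M_def using assms by (rule is_right_module_regular)
  have A: "alg_obj A \<in> Ob C" using X by (simp add: Xmu)
  let ?E = "mod_hom C A M M" and ?ev = "mod_ev C A M M"
  let ?c = "mod_comp C A M M M" and ?j = "mod_id C A M"
  note c = mod_ev_mod_comp[OF M M M A, unfolded Mr]
    and j = mod_ev_mod_id[OF M A, unfolded Mr]
    and ev = mod_ev_hom[OF M M A, unfolded Mr]
    and act = mod_ev_act[OF M M A, unfolded Mr, folded Xmu(1)]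
    and ext = mod_ev_ext[OF M M A, unfolded Mr]
  have E: "?E \<in> Ob C" using j(1) hom_Ob by blast
  note iE = Ident_hom[OF E] and iX = Ident_hom[OF X]
  \<comment> \<open>Linearity of \<open>m\<close> in its second factor, needed for the lift, is
    associativity of \<open>A\<close>.\<close>
  obtain f where f: "f \<in> hom C X ?E" and ev_f: "?ev \<cdot> (f \<boxtimes> \<I> X) = m"
    by (rule mod_ev_lift[OF M M A X, unfolded Mr, OF m]) (use mm in \<open>simp_all add: Xmu\<close>)
  have ev_f': "?ev \<cdot> ((f \<cdot> a) \<boxtimes> x) = m \<cdot> (a \<boxtimes> x)"
    if a: "a \<in> hom C V X" and x: "x \<in> hom C W X" for a x V W
    using Tensor_Comp_left(1)[OF a f x] ev_f
      Comp_assoc[OF Tensor_hom[OF a x] Tensor_hom[OF f iX] ev(1)] by simp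
  \<comment> \<open>Evaluation at the unit \<open>u\<close>; its source
    \<open>?E \<otimes> \<one>\<close> is \<open>?E\<close> by strictness.\<close>
  define g where "g = ?ev \<cdot> (\<I> ?E \<boxtimes> u)"
  have g: "g \<in> hom C ?E X"
    unfolding g_def using ev(2)[OF iE u] by (simp add: TensorO_Unit E)
  have gf: "g \<cdot> f = \<I> X"
  proof -
    \<comment> \<open>Tensoring with the identity of \<open>\<one>\<close> puts \<open>f\<close>
      into a form to which interchange applies.\<close>
    have "f = f \<boxtimes> \<I> \<one>" using f by (simp add: TensorA_Unit hom_Arr)
    then have "(\<I> ?E \<boxtimes> u) \<cdot> f = f \<boxtimes> u"
      using Comp_Tensor[OF f iE Ident_hom[OF Unit_Ob] u] f u by (simp add: Ident_Comp Comp_Ident)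
    then have "g \<cdot> f = ?ev \<cdot> (f \<boxtimes> u)"
      unfolding g_def using Comp_assoc[OF f _ ev(1)] Tensor_hom[OF iE u]
      by (simp add: TensorO_Unit E)
    \<comment> \<open>Left multiplication by \<open>a\<close>, evaluated at \<open>u\<close>, is
      \<open>a u = a\<close>: the right unit law.\<close>
    also have "\<dots> = \<I> X" using ev_f'[OF iX u] f by (simp add: Comp_Ident mu)
    finally show ?thesis .
  qed
  have fg: "f \<cdot> g = \<I> ?E"
  proof (rule ext[OF _ iE])
    show "f \<cdot> g \<in> hom C ?E ?E" using g f by (rule Comp_hom)
    have "?ev \<cdot> ((f \<cdot> g) \<boxtimes> \<I> X) = m \<cdot> (g \<boxtimes> \<I> X)" using g iX by (rule ev_f')
    \<comment> \<open>In generalized elements, \<open>h(u) x = h(u x)\<close> by linearity of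
      \<open>h\<close>; the left unit law then turns \<open>u x\<close> into
      \<open>x\<close>.\<close>
    also have "\<dots> = ?ev \<cdot> (\<I> ?E \<boxtimes> (m \<cdot> (u \<boxtimes> \<I> X)))"
      unfolding g_def using act[OF iE u iX] by simp
    finally show "?ev \<cdot> ((f \<cdot> g) \<boxtimes> \<I> X) = ?ev \<cdot> (\<I> ?E \<boxtimes> \<I> X)" by (simp add: mu)
  qed
  have "f \<cdot> m = ?c \<cdot> (f \<boxtimes> f)"
  proof (rule ext)
    show "f \<cdot> m \<in> hom C (X \<otimes> X) ?E" using m f by (rule Comp_hom)
    show "?c \<cdot> (f \<boxtimes> f) \<in> hom C (X \<otimes> X) ?E" using Tensor_hom[OF f f] c(1) by (rule Comp_hom)
    \<comment> \<open>Composing the left multiplications by \<open>a\<close> and \<open>b\<close>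
      and applying the result to \<open>x\<close> gives \<open>a (b x)\<close>, while
      \<open>f \<cdot> m\<close> gives \<open>(a b) x\<close>; associativity of \<open>A\<close>
      identifies them.\<close>
    have "?ev \<cdot> ((?c \<cdot> (f \<boxtimes> f)) \<boxtimes> \<I> X) = ?ev \<cdot> (f \<boxtimes> m)"
      using c(2)[OF f f iX] by (simp add: ev_f)
    also have "\<dots> = m \<cdot> (\<I> X \<boxtimes> m)" using ev_f'[OF iX m] f by (simp add: Comp_Ident)
    finally show "?ev \<cdot> ((f \<cdot> m) \<boxtimes> \<I> X) = ?ev \<cdot> ((?c \<cdot> (f \<boxtimes> f)) \<boxtimes> \<I> X)"
      using ev_f'[OF m iX] mm by simp
  qed
  moreover have "f \<cdot> u = ?j"
  proof (rule ext[OF _ j(1)])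
    show "f \<cdot> u \<in> hom C \<one> ?E" using u f by (rule Comp_hom)
    \<comment> \<open>Left multiplication by the unit is the identity: the left unit law
      again.\<close>
    show "?ev \<cdot> ((f \<cdot> u) \<boxtimes> \<I> X) = ?ev \<cdot> (?j \<boxtimes> \<I> X)"
      using ev_f'[OF u iX] j(2)[OF iX] mu by simp
  qed
  ultimately have "is_algebra_hom C A (mod_end C A M) f"
    using f by (simp add: is_algebra_hom_def mod_end_def Xmu)
  then show ?thesis
    unfolding M_def[symmetric]
    using assms is_algebra_mod_end[OF M A] g gf fg
    by (intro isomorphic_algebrasI) (simp_all add: mod_end_def Xmu)
qed

end

theorem theorem3p18:
  fixes C :: "('o, 'a) closed_monoidal_eq" and A :: "('o, 'a) alg"
  assumes "right_closed_monoidal_category_with_equalizers C"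
    and "is_algebra C A"
  shows "isomorphic_algebras C A (mod_end C A (regular_module A))"
  using assms
  by (rule right_closed_monoidal_category_with_equalizers.isomorphic_algebras_mod_end_regular)

end
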